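(* Let $(P,\mathcal{T},c)$ be a set covering instance, and let $\mathcal{C}^{**}$ be the family of pairs defined in the context. Then every family $\bar{\mathcal{C}}$ with $\mathcal{C}^{**}\subseteq\bar{\mathcal{C}}\subseteq\mathcal{C}$ determines the happy nucleolus of $(P,\mathcal{T},c)$; that is, the happy nucleolus is the unique vector $y$ that lexicographically maximizes $\theta^y[\bar{\mathcal{C}}]$ among all $y\in\mathbb{R}^P_{\ge 0}$ with $y(P)=\mathrm{LP}(P,\mathcal{T},c)$.
   Context: A set covering instance $(P,\mathcal{T},c)$ consists of a finite set $P$ (of players), a family $\mathcal{T}$ of subsets of $P$ whose union is $P$, and costs $c:\mathcal{T}\to\mathbb{R}_{\ge 0}$. For $\mathcal{U}\subseteq\mathcal{T}$ write $c(\mathcal{U})=\sum_{T\in\mathcal{U}}c(T)$; $\mathcal{U}$ covers $S\subseteq P$ if every element of $S$ lies in some set of $\mathcal{U}$. For $y\in\mathbb{R}^P$ and $S\subseteq P$ write $y(S)=\sum_{p\in S}y_p$. A coalition is a nonempty subset of $P$. Let $\mathcal{C}$ be the set of pairs $(S,\mathcal{U})$ with $\emptyset\ne S\subseteq P$, $\mathcal{U}\subseteq\mathcal{T}$ and $\mathcal{U}$ covering $S$. For $y\in\mathbb{R}^P_{\ge0}$, the excess of $(S,\mathcal{U})\in\mathcal{C}$ is $\theta^y(S,\mathcal{U})=c(\mathcal{U})-y(S)$, and the excess of a coalition $S$ is $\theta^y(S)=\min\{\theta^y(S,\mathcal{U}):\mathcal{U}\subseteq\mathcal{T}\text{ covers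 }S\}$. The excess vector $\theta^y$ lists $\theta^y(S)$ for all coalitions $S$ in nondecreasing order; for $\mathcal{C}'\subseteq\mathcal{C}$, the vector $\theta^y[\mathcal{C}']$ lists $\theta^y(S,\mathcal{U})$ for $(S,\mathcal{U})\in\mathcal{C}'$ in nondecreasing order. Let $\mathrm{LP}(P,\mathcal{T},c)=\min\{\sum_{T\in\mathcal{T}}c(T)x_T: x\in\mathbb{R}^{\mathcal{T}}_{\ge0},\ \sum_{T\ni p}x_T\ge1\ \forall p\in P\}$ (minimum cost of a fractional cover). The happy nucleolus is the (unique) vector $y\in\mathbb{R}^P_{\ge0}$ with $y(P)=\mathrm{LP}(P,\mathcal{T},c)$ that lexicographically maximizes $\theta^y$ among all such vectors. A family $\mathcal{C}'\subseteq\mathcal{C}$ determines the happy nucleolus if the happy nucleolus is the unique vector lexicographically maximizing $\theta^y[\mathcal{C}']$ among all $y\in\mathbb{R}^P_{\ge0}$ with $y(P)=\mathrm{LP}(P,\mathcal{T},c)$. Define $\mathcal{C}^*=\{(S,\{T\}): T\in\mathcal{T},\ S\notin\{\emptyset,P\},\ S=T\text{ or }S=T\setminus\{p\}\text{ for some }p\in T\}$ and $\mathcal{C}^{**}=\{(S,\{T\})\in\mathcal{C}^*: c(T)=\min\{c(\mathcal{U}):\mathcal{U}\subseteq\mathcal{T}\text{ covers }S\}\}$. *)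

theory Defs
  imports Complex_Main "HOL-Library.FuncSet" "HOL-Library.Multiset" "HOL-Library.List_Lexorder"
begin

locale set_covering_instance =
  fixes P :: "'a set" and \<T> :: "'a set set" and c :: "'a set \<Rightarrow> real"
  assumes finite_players: "finite P"
    and Union_family: "\<Union>\<T> = P"
    and cost_nonneg: "\<And>T. T \<in> \<T> \<Longrightarrow> 0 \<le> c T"

definition coalitions :: "'a set \<Rightarrow> 'a set set" where
  "coalitions P = {S. S \<noteq> {} \<and> S \<subseteq> P}"

definition covers_of :: "'a set set \<Rightarrow> 'a set \<Rightarrow> 'a set set set" where
  "covers_of \<T> S = {\<U>. \<U> \<subseteq> \<T> \<and> S \<subseteq> \<Union>\<U>}"

definition covering_pairs :: "'a set \<Rightarrow> 'a set set \<Rightarrow> ('a set \<times> 'a set set) set" where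
  "covering_pairs P \<T> = {(S, \<U>). S \<in> coalitions P \<and> \<U> \<in> covers_of \<T> S}"

definition pair_excess ::
    "('a set \<Rightarrow> real) \<Rightarrow> ('a \<Rightarrow> real) \<Rightarrow> 'a set \<times> 'a set set \<Rightarrow> real" where
  "pair_excess c y = (\<lambda>(S, \<U>). sum c \<U> - sum y S)"

definition coalition_excess ::
    "'a set set \<Rightarrow> ('a set \<Rightarrow> real) \<Rightarrow> ('a \<Rightarrow> real) \<Rightarrow> 'a set \<Rightarrow> real" where
  "coalition_excess \<T> c y S = Min ((\<lambda>\<U>. pair_excess c y (S, \<U>)) ` covers_of \<T> S)"

text \<open>The values of \<open>f\<close> on a finite set \<open>A\<close>, one entry per element of \<open>A\<close> (so with
  repetitions), in nondecreasing order.\<close>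

definition sorted_values :: "('b \<Rightarrow> real) \<Rightarrow> 'b set \<Rightarrow> real list" where
  "sorted_values f A = sorted_list_of_multiset (image_mset f (mset_set A))"

definition excess_vector ::
    "'a set \<Rightarrow> 'a set set \<Rightarrow> ('a set \<Rightarrow> real) \<Rightarrow> ('a \<Rightarrow> real) \<Rightarrow> real list" where
  "excess_vector P \<T> c y = sorted_values (coalition_excess \<T> c y) (coalitions P)"

definition excess_vector_on ::
    "('a set \<times> 'a set set) set \<Rightarrow> ('a set \<Rightarrow> real) \<Rightarrow> ('a \<Rightarrow> real) \<Rightarrow> real list" where
  "excess_vector_on \<C> c y = sorted_values (pair_excess c y) \<C>"

definition fractional_covers :: "'a set \<Rightarrow> 'a set set \<Rightarrow> ('a set \<Rightarrow> real) set" where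
  "fractional_covers P \<T> =
     {x \<in> \<T> \<rightarrow>\<^sub>E {0..}. \<forall>p\<in>P. (\<Sum>T\<in>{T \<in> \<T>. p \<in> T}. x T) \<ge> 1}"

text \<open>For a set covering instance the infimum is attained: the linear program is feasible
  and bounded below by 0.\<close>

definition lp_value :: "'a set \<Rightarrow> 'a set set \<Rightarrow> ('a set \<Rightarrow> real) \<Rightarrow> real" where
  "lp_value P \<T> c = (INF x\<in>fractional_covers P \<T>. \<Sum>T\<in>\<T>. c T * x T)"

text \<open>A vector indexed by \<open>P\<close> is a function that is \<open>undefined\<close> outside \<open>P\<close>, so equality of
  such functions is equality of vectors.\<close>

definition allocations :: "'a set \<Rightarrow> 'a set set \<Rightarrow> ('a set \<Rightarrow> real) \<Rightarrow> ('a \<Rightarrow> real) set" where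
  "allocations P \<T> c = {y \<in> P \<rightarrow>\<^sub>E {0..}. sum y P = lp_value P \<T> c}"

text \<open>Lists are compared by the lexicographic (linear) order of \<open>List_Lexorder\<close>; the lists
  compared here all have the same length.\<close>

definition lex_maximizes ::
    "(('a \<Rightarrow> real) \<Rightarrow> real list) \<Rightarrow> ('a \<Rightarrow> real) set \<Rightarrow> ('a \<Rightarrow> real) \<Rightarrow> bool" where
  "lex_maximizes \<theta> Y y \<longleftrightarrow> is_arg_max \<theta> (\<lambda>z. z \<in> Y) y"

definition happy_nucleolus :: "'a set \<Rightarrow> 'a set set \<Rightarrow> ('a set \<Rightarrow> real) \<Rightarrow> 'a \<Rightarrow> real" where
  "happy_nucleolus P \<T> c = (THE y. lex_maximizes (excess_vector P \<T> c) (allocations P \<T> c) y)"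

definition determines_happy_nucleolus ::
    "'a set \<Rightarrow> 'a set set \<Rightarrow> ('a set \<Rightarrow> real) \<Rightarrow> ('a set \<times> 'a set set) set \<Rightarrow> bool" where
  "determines_happy_nucleolus P \<T> c \<C> \<longleftrightarrow>
     {y. lex_maximizes (excess_vector_on \<C> c) (allocations P \<T> c) y} = {happy_nucleolus P \<T> c}"

definition C_star :: "'a set \<Rightarrow> 'a set set \<Rightarrow> ('a set \<times> 'a set set) set" where
  "C_star P \<T> =
     {(S, {T}) | S T. T \<in> \<T> \<and> S \<notin> {{}, P} \<and> (S = T \<or> (\<exists>p\<in>T. S = T - {p}))}"

definition C_star_star ::
    "'a set \<Rightarrow> 'a set set \<Rightarrow> ('a set \<Rightarrow> real) \<Rightarrow> ('a set \<times> 'a set set) set" where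
  "C_star_star P \<T> c =
     {(S, {T}) | S T. (S, {T}) \<in> C_star P \<T> \<and> c T = Min (sum c ` covers_of \<T> S)}"

end

theory Submission
  imports Defs "HOL-Analysis.Function_Topology"
begin

text \<open>
  Let \<open>y\<close> be lexicographically maximal for \<open>C_star_star\<close>; it exists by compactness.
  By linear programming duality some allocation charges no \<open>T\<close> more than \<open>c T\<close>, and hence neither
  does \<open>y\<close>.  For such \<open>y\<close> the incidence vector of the coalition of any covering pair
  of excess \<open>e\<close> is a linear combination of the incidence vectors of \<open>P\<close> and of
  coalitions in \<open>C_star_star\<close> of excess at most \<open>e\<close>.  Now suppose that another allocation \<open>z\<close>
  is at least as good as \<open>y\<close> for a larger family, and let \<open>e\<close> be the first level at which the
  excesses of \<open>y\<close> and \<open>z\<close> differ.  By the spanning property they already differ at level \<open>e\<close> on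
  \<open>C_star_star\<close>, so that \<open>(y + z) / 2\<close> beats \<open>y\<close> there, a contradiction.  The argument only uses
  the excess functions in the family, so it applies to \<open>excess_vector\<close> as well.
\<close>

section \<open>Lexicographic comparison of sorted vectors\<close>

lemma sorted_sorted_values: "sorted (sorted_values g A)"
  by (simp add: sorted_values_def)

lemma mset_sorted_values: "mset (sorted_values g A) = image_mset g (mset_set A)"
  by (simp add: sorted_values_def)

lemma length_sorted_values: "length (sorted_values g A) = card A"
  by (metis mset_sorted_values size_image_mset size_mset size_mset_set)

text \<open>The entries at most \<open>v\<close> of a sorted list form an initial segment, so order
  statistics are located by counting. The comparisons of sorted vectors below rest on such
  counts.\<close>

lemma sorted_nth_le_iff:
  fixes xs :: "'b::linorder list"
  assumes "sorted xs" "k < length xs"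
  shows "xs ! k \<le> v \<longleftrightarrow> k < length (filter (\<lambda>x. x \<le> v) xs)"
  using assms
proof (induction xs arbitrary: k)
  case (Cons a xs)
  have *: "filter (\<lambda>x. x \<le> v) xs = []" if "\<not> a \<le> v"
    using Cons.prems(1) that by (auto simp: filter_empty_conv)
  show ?case
  proof (cases k)
    case 0
    then show ?thesis using * by auto
  next
    case (Suc j)
    then have j: "j < length xs" using Cons.prems by simp
    have "a \<le> xs ! j" using Cons.prems(1) j by auto
    then show ?thesis using Suc Cons.IH[of j] Cons.prems(1) j * by auto
  qed
qed simp

lemma sorted_values_nth_le_iff:
  assumes "finite A" "k < card A"
  shows "sorted_values g A ! k \<le> v \<longleftrightarrow> k < card {i \<in> A. g i \<le> v}"
proof -
  have "length (filter (\<lambda>x. x \<le> v) (sorted_values g A))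
      = size (filter_mset (\<lambda>x. x \<le> v) (image_mset g (mset_set A)))"
    by (metis mset_filter mset_sorted_values size_mset)
  also have "\<dots> = card {i \<in> A. g i \<le> v}"
    using assms(1) by (simp add: filter_mset_image_mset)
  finally show ?thesis
    using sorted_nth_le_iff[OF sorted_sorted_values, of k g A v] assms(2)
    by (simp add: length_sorted_values)
qed

text \<open>Below the level \<open>e\<close> both functions have the same counts, while strictly
  fewer values of \<open>h\<close> than of \<open>g\<close> are at most \<open>e\<close>. Hence the
  vectors first differ where the one for \<open>h\<close> first exceeds \<open>e\<close>.\<close>

lemma sorted_values_less:
  assumes fin: "finite J"
    and lt: "\<And>j. j \<in> J \<Longrightarrow> g j < e \<Longrightarrow> h j = g j"
    and eq: "\<And>j. j \<in> J \<Longrightarrow> g j = e \<Longrightarrow> e \<le> h j"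
    and gt: "\<And>j. j \<in> J \<Longrightarrow> e < g j \<Longrightarrow> e < h j"
    and strict: "j\<^sub>0 \<in> J" "g j\<^sub>0 = e" "e < h j\<^sub>0"
  shows "sorted_values g J < sorted_values h J"
proof -
  define k where "k = card {j \<in> J. h j \<le> e}"
  have "{j \<in> J. h j \<le> e} \<subset> {j \<in> J. g j \<le> e}"
    using strict gt by (auto simp: not_less[symmetric])
  then have k: "k < card {j \<in> J. g j \<le> e}"
    unfolding k_def by (intro psubset_card_mono) (use fin in auto)
  also have "\<dots> \<le> card J" using fin by (intro card_mono) auto
  finally have kJ: "k < card J" .
  have cnt: "{j \<in> J. g j \<le> v} = {j \<in> J. h j \<le> v}" if "v < e" for v
  proof -
    have "g j \<le> v \<longleftrightarrow> h j \<le> v" if j: "j \<in> J" for j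
      using lt[OF j] eq[OF j] gt[OF j] \<open>v < e\<close> by (cases "g j" e rule: linorder_cases) auto
    then show ?thesis by blast
  qed
  have nth_eq: "sorted_values g J ! i = sorted_values h J ! i" if "i < k" for i
  proof -
    let ?a = "sorted_values g J ! i" and ?b = "sorted_values h J ! i"
    have i: "i < card J" using that kJ by simp
    note ga = sorted_values_nth_le_iff[OF fin i, of g] and hb = sorted_values_nth_le_iff[OF fin i, of h]
    have "?a \<le> e" "?b \<le> e" using ga[of e] hb[of e] k that by (auto simp: k_def)
    moreover have "?a \<le> v \<longleftrightarrow> ?b \<le> v" if "v < e" for v
      using ga[of v] hb[of v] cnt[OF that] by simp
    ultimately show ?thesis
      by (metis order.antisym order.refl order.not_eq_order_implies_strict)
  qed
  have "sorted_values g J ! k \<le> e" "e < sorted_values h J ! k"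
    using sorted_values_nth_le_iff[OF fin kJ, of g e] sorted_values_nth_le_iff[OF fin kJ, of h e] k
    by (auto simp: k_def not_le[symmetric])
  moreover have "take k (sorted_values g J) = take k (sorted_values h J)"
    using nth_eq kJ by (intro nth_equalityI) (auto simp: length_sorted_values)
  ultimately show ?thesis
    unfolding list_less_def lexord_take_index_conv
    using kJ by (auto simp: length_sorted_values)
qed

text \<open>Here \<open>e\<close> is the least value that either function takes at an index where
  they differ. If no index had \<open>g i = e\<close> and \<open>e < h i\<close>, the preceding
  lemma with \<open>g\<close> and \<open>h\<close> exchanged would make the vector for
  \<open>h\<close> strictly smaller.\<close>

lemma sorted_values_le_cases:
  assumes fin: "finite I" and le: "sorted_values g I \<le> sorted_values h I"
    and ex: "\<exists>i\<in>I. g i \<noteq> h i"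
  obtains e i where "i \<in> I" "g i = e" "e < h i"
    and "\<And>j. j \<in> I \<Longrightarrow> g j < e \<Longrightarrow> h j = g j"
    and "\<And>j. j \<in> I \<Longrightarrow> e \<le> g j \<Longrightarrow> e \<le> h j"
proof -
  define M where "M = (\<lambda>i. min (g i) (h i)) ` {i \<in> I. g i \<noteq> h i}"
  define e where "e = Min M"
  have M: "finite M" "M \<noteq> {}" using fin ex by (auto simp: M_def)
  have lower: "e \<le> g j" "e \<le> h j" if "j \<in> I" "g j \<noteq> h j" for j
  proof -
    have "e \<le> min (g j) (h j)" unfolding e_def
      by (rule Min_le) (use M that in \<open>auto simp: M_def\<close>)
    then show "e \<le> g j" "e \<le> h j" by auto
  qed
  obtain m where m: "m \<in> I" "g m \<noteq> h m" "e = min (g m) (h m)"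
    using Min_in[OF M] by (auto simp: e_def M_def)
  have "\<exists>i\<in>I. g i = e \<and> e < h i"
  proof (rule ccontr)
    assume no: "\<not> ?thesis"
    have "sorted_values h I < sorted_values g I"
    proof (rule sorted_values_less[OF fin])
      show "m \<in> I" "h m = e" "e < g m" using m no by (auto simp: min_def split: if_splits)
    next
      fix j assume j: "j \<in> I"
      show "g j = h j" if "h j < e" using lower[OF j] that by force
      show "e \<le> g j" if "h j = e" using lower[OF j] that by force
      show "e < g j" if "e < h j" using lower[OF j] that no j by force
    qed
    with le show False by simp
  qed
  then obtain i where "i \<in> I" "g i = e" "e < h i" by blast
  then show ?thesis
  proof (rule that)
    fix j assume j: "j \<in> I"
    show "h j = g j" if "g j < e" using lower[OF j] that by force
    show "e \<le> h j" if "e \<le> g j" using lower[OF j] that by force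
  qed
qed

section \<open>Continuity of sorted vectors and existence of lexicographic maximizers\<close>

lemma sorted_values_nth_le:
  assumes fin: "finite A" and k: "k < card A" and le: "\<And>i. i \<in> A \<Longrightarrow> h i \<le> g i + \<delta>"
  shows "sorted_values h A ! k \<le> sorted_values g A ! k + \<delta>"
proof -
  let ?v = "sorted_values g A ! k"
  have *: "h i \<le> ?v + \<delta>" if "i \<in> A" "g i \<le> ?v" for i using le[OF that(1)] that(2) by linarith
  have "k < card {i \<in> A. g i \<le> ?v}" using sorted_values_nth_le_iff[OF fin k, of g ?v] by simp
  also have "\<dots> \<le> card {i \<in> A. h i \<le> ?v + \<delta>}"
    using fin * by (intro card_mono) auto
  finally show ?thesis using sorted_values_nth_le_iff[OF fin k] by blast
qed

text \<open>By the preceding estimate, used in both directions, each order statistic is 1-Lipschitz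
  in the supremum norm of the finitely many values.\<close>

lemma continuous_on_sorted_values_nth:
  assumes fin: "finite A" and k: "k < card A" and cont: "\<And>i. i \<in> A \<Longrightarrow> continuous_on Y (f i)"
  shows "continuous_on Y (\<lambda>y. sorted_values (\<lambda>i. f i y) A ! k)"
  unfolding continuous_on_def
proof (intro ballI tendstoI)
  fix x and \<epsilon> :: real assume x: "x \<in> Y" and "0 < \<epsilon>"
  have "\<forall>\<^sub>F y in at x within Y. dist (f i y) (f i x) < \<epsilon> / 2" if "i \<in> A" for i
    using cont[OF that] x \<open>0 < \<epsilon>\<close> by (intro tendstoD) (auto simp: continuous_on_def)
  then have "\<forall>\<^sub>F y in at x within Y. \<forall>i\<in>A. dist (f i y) (f i x) < \<epsilon> / 2"
    using fin by (simp add: eventually_ball_finite)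
  then show "\<forall>\<^sub>F y in at x within Y.
      dist (sorted_values (\<lambda>i. f i y) A ! k) (sorted_values (\<lambda>i. f i x) A ! k) < \<epsilon>"
  proof (rule eventually_mono)
    fix y assume *: "\<forall>i\<in>A. dist (f i y) (f i x) < \<epsilon> / 2"
    have "f i y \<le> f i x + \<epsilon> / 2 \<and> f i x \<le> f i y + \<epsilon> / 2" if "i \<in> A" for i
      using bspec[OF * that] unfolding dist_real_def by linarith
    then have "sorted_values (\<lambda>i. f i y) A ! k \<le> sorted_values (\<lambda>i. f i x) A ! k + \<epsilon> / 2"
      "sorted_values (\<lambda>i. f i x) A ! k \<le> sorted_values (\<lambda>i. f i y) A ! k + \<epsilon> / 2"
      by (auto intro!: sorted_values_nth_le[OF fin k])
    then show "dist (sorted_values (\<lambda>i. f i y) A ! k) (sorted_values (\<lambda>i. f i x) A ! k) < \<epsilon>"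
      using \<open>0 < \<epsilon>\<close> by (simp add: dist_real_def abs_if)
  qed
qed

lemma continuous_on_sum_coordinates: "continuous_on Y (\<lambda>y :: 'a \<Rightarrow> real. sum y S)"
  by (rule continuous_on_subset[OF continuous_on_sum[OF continuous_on_product_coordinates] subset_UNIV])

text \<open>Maximize the head of the list first. Its maximizers form a relatively closed, hence
  compact, subset of \<open>Y\<close>, on which the remaining functions are treated in the same
  way.\<close>

lemma lex_max_exists:
  fixes fs :: "('y::topological_space \<Rightarrow> real) list"
  assumes "compact Y" "Y \<noteq> {}" "\<forall>f\<in>set fs. continuous_on Y f"
  shows "\<exists>y\<in>Y. \<forall>z\<in>Y. map (\<lambda>f. f z) fs \<le> map (\<lambda>f. f y) fs"
  using assms
proof (induction fs arbitrary: Y)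
  case (Cons f fs)
  then obtain m where m: "m \<in> Y" "\<forall>z\<in>Y. f z \<le> f m"
    using continuous_attains_sup[of Y f] by auto
  let ?Z = "{z \<in> Y. f z = f m}"
  have "compact ?Z"
    by (rule closedin_compact[OF Cons.prems(1)], rule continuous_closedin_preimage_constant)
      (use Cons.prems in auto)
  moreover have "\<forall>g\<in>set fs. continuous_on ?Z g"
    using Cons.prems(3) by (auto intro: continuous_on_subset)
  ultimately obtain y where y: "y \<in> ?Z" "\<forall>z\<in>?Z. map (\<lambda>f. f z) fs \<le> map (\<lambda>f. f y) fs"
    using Cons.IH[of ?Z] m(1) by auto
  have "map (\<lambda>f. f z) (f # fs) \<le> map (\<lambda>f. f y) (f # fs)" if "z \<in> Y" for z
    using y m that by (cases "f z = f m") (auto simp: less_le)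
  then show ?case using y(1) by blast
qed auto

lemma sorted_values_max_exists:
  fixes Y :: "'y::topological_space set"
  assumes fin: "finite A" and "compact Y" "Y \<noteq> {}"
    and "\<And>i. i \<in> A \<Longrightarrow> continuous_on Y (f i)"
  shows "\<exists>y\<in>Y. \<forall>z\<in>Y. sorted_values (\<lambda>i. f i z) A \<le> sorted_values (\<lambda>i. f i y) A"
proof -
  let ?fs = "map (\<lambda>k y. sorted_values (\<lambda>i. f i y) A ! k) [0..<card A]"
  have "map (\<lambda>\<phi>. \<phi> y) ?fs = sorted_values (\<lambda>i. f i y) A" for y
    by (rule nth_equalityI) (auto simp: length_sorted_values)
  moreover have "\<exists>y\<in>Y. \<forall>z\<in>Y. map (\<lambda>\<phi>. \<phi> z) ?fs \<le> map (\<lambda>\<phi>. \<phi> y) ?fs"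
    by (rule lex_max_exists) (use assms in \<open>auto intro!: continuous_on_sorted_values_nth\<close>)
  ultimately show ?thesis by simp
qed

section \<open>Linear programming duality for covers\<close>

text \<open>A Taylor bound for the squared positive part, whose derivative at \<open>a\<close> is
  \<open>2 * max 0 a\<close>. It yields the first-order conditions of the penalty argument without
  differentiation.\<close>

lemma pos_part_sq_add_le: "(max 0 (a + h))\<^sup>2 \<le> (max 0 a)\<^sup>2 + 2 * max 0 a * h + h\<^sup>2" for a h :: real
proof (cases "0 \<le> a"; cases "0 \<le> a + h")
  assume "\<not> 0 \<le> a" "0 \<le> a + h"
  then have "a + h \<le> h" "0 \<le> a + h" by auto
  then have "(a + h)\<^sup>2 \<le> h\<^sup>2" by (intro power_mono)
  then show ?thesis using \<open>\<not> 0 \<le> a\<close> \<open>0 \<le> a + h\<close> by simp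
next
  assume "0 \<le> a" "\<not> 0 \<le> a + h"
  moreover have "0 \<le> (a + h)\<^sup>2" by simp
  ultimately show ?thesis by (simp add: power2_eq_square algebra_simps)
qed (auto simp: power2_eq_square algebra_simps)

context set_covering_instance
begin

lemma finite_family: "finite \<T>"
  by (rule finite_subset[of _ "Pow P"]) (use Union_family finite_players in auto)

lemma finite_member: "T \<in> \<T> \<Longrightarrow> finite T"
  using Union_family finite_players by (auto intro: finite_subset[of _ P])

lemma finite_covers_of: "finite (covers_of \<T> S)"
  by (rule finite_subset[of _ "Pow \<T>"]) (use finite_family in \<open>auto simp: covers_of_def\<close>)

lemma finite_coalitions: "finite (coalitions P)"
  by (rule finite_subset[of _ "Pow P"]) (use finite_players in \<open>auto simp: coalitions_def\<close>)

lemma finite_covering_pairs: "finite (covering_pairs P \<T>)"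
  by (rule finite_subset[of _ "Pow P \<times> Pow \<T>"])
    (use finite_players finite_family in \<open>auto simp: covering_pairs_def coalitions_def covers_of_def\<close>)

text \<open>Double counting of the incidences \<open>p \<in> T\<close>. With \<open>x\<close>
  constantly 1 it brings in the multiplicities with which \<open>\<U>\<close> covers the
  players.\<close>

lemma sum_members_swap:
  assumes "\<U> \<subseteq> \<T>"
  shows "(\<Sum>T\<in>\<U>. x T * sum y T) = (\<Sum>p\<in>P. y p * (\<Sum>T\<in>{T \<in> \<U>. p \<in> T}. x T :: real))"
proof -
  have fin: "finite \<U>" using assms finite_family finite_subset by blast
  have "(\<Sum>T\<in>\<U>. x T * sum y T) = (\<Sum>T\<in>\<U>. \<Sum>p\<in>{p \<in> P. p \<in> T}. x T * y p)"
  proof (rule sum.cong[OF refl])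
    fix T assume "T \<in> \<U>"
    then have "{p \<in> P. p \<in> T} = T" using assms Union_family by blast
    then show "x T * sum y T = (\<Sum>p\<in>{p \<in> P. p \<in> T}. x T * y p)" by (simp add: sum_distrib_left)
  qed
  also have "\<dots> = (\<Sum>p\<in>P. \<Sum>T\<in>{T \<in> \<U>. p \<in> T}. x T * y p)"
    by (rule sum.swap_restrict[OF fin finite_players])
  finally show ?thesis by (simp add: sum_distrib_left mult.commute)
qed

lemma
  shows lp_value_le: "x \<in> fractional_covers P \<T> \<Longrightarrow> lp_value P \<T> c \<le> (\<Sum>T\<in>\<T>. c T * x T)"
    and lp_value_nonneg: "0 \<le> lp_value P \<T> c"
proof -
  have "(\<lambda>T\<in>\<T>. 1) \<in> fractional_covers P \<T>"
  proof -
    have "1 \<le> (\<Sum>T\<in>{T \<in> \<T>. p \<in> T}. (\<lambda>T\<in>\<T>. 1::real) T)" if p: "p \<in> P" for p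
    proof -
      have "{T \<in> \<T>. p \<in> T} \<noteq> {}" using p Union_family by blast
      then have "0 < card {T \<in> \<T>. p \<in> T}" using finite_family by (simp add: card_gt_0_iff)
      then show ?thesis by simp
    qed
    then show ?thesis by (auto simp: fractional_covers_def)
  qed
  then have ne: "fractional_covers P \<T> \<noteq> {}" by blast
  have nonneg: "0 \<le> (\<Sum>T\<in>\<T>. c T * x T)" if "x \<in> fractional_covers P \<T>" for x
    using that cost_nonneg by (auto simp: fractional_covers_def PiE_iff intro!: sum_nonneg)
  show "0 \<le> lp_value P \<T> c"
    unfolding lp_value_def by (rule cINF_greatest[OF ne nonneg])
  show "lp_value P \<T> c \<le> (\<Sum>T\<in>\<T>. c T * x T)" if "x \<in> fractional_covers P \<T>"
    unfolding lp_value_def by (rule cINF_lower[OF _ that]) (use nonneg in \<open>auto intro!: bdd_belowI2\<close>)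
qed

text \<open>No pair in \<open>C_star\<close> has the coalition \<open>P\<close>, so for
  \<open>P \<in> \<T>\<close> the bound \<open>sum y P \<le> c P\<close> has to come from the cover
  that uses \<open>P\<close> alone.\<close>

lemma lp_value_le_cost_P:
  assumes "P \<in> \<T>"
  shows "lp_value P \<T> c \<le> c P"
proof -
  let ?x = "\<lambda>T\<in>\<T>. if T = P then 1 else 0 :: real"
  have "?x \<in> fractional_covers P \<T>"
    using assms finite_family by (auto simp: fractional_covers_def)
  moreover have "(\<Sum>T\<in>\<T>. c T * ?x T) = (\<Sum>T\<in>\<T>. if T = P then c T else 0)"
    by (intro sum.cong) auto
  ultimately show ?thesis
    using lp_value_le[of ?x] assms finite_family by simp
qed

lemma lp_value_empty:
  assumes "P = {}"
  shows "lp_value P \<T> c = 0"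
proof -
  have "(\<lambda>T\<in>\<T>. 0) \<in> fractional_covers P \<T>" using assms by (auto simp: fractional_covers_def)
  from lp_value_le[OF this] show ?thesis using lp_value_nonneg by simp
qed

section \<open>The set of allocations: nonempty, compact, convex, closed under small
  transfers\<close>

lemma allocations_nonempty: "allocations P \<T> c \<noteq> {}"
proof (cases "P = {}")
  case True
  then show ?thesis using lp_value_empty by (auto simp: allocations_def)
next
  case False
  then obtain p where "p \<in> P" by blast
  then have "(\<lambda>q\<in>P. if q = p then lp_value P \<T> c else 0) \<in> allocations P \<T> c"
    using lp_value_nonneg finite_players by (auto simp: allocations_def)
  then show ?thesis by blast
qed

lemma allocationsD:
  assumes "y \<in> allocations P \<T> c"
  shows "\<And>p. p \<in> P \<Longrightarrow> 0 \<le> y p" "sum y P = lp_value P \<T> c"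
  using assms by (auto simp: allocations_def)

text \<open>Coordinates outside \<open>P\<close> range over the singleton of
  \<open>undefined\<close>, the others over a bounded interval. So Tychonoff applies to the box, and
  the condition on the total is closed.\<close>

lemma compact_allocations: "compact (allocations P \<T> c)"
proof -
  let ?L = "lp_value P \<T> c"
  let ?B = "PiE UNIV (\<lambda>p. if p \<in> P then {0..?L} else {undefined})"
  have B: "compact ?B"
    using compactin_PiE[of "\<lambda>_. euclidean" UNIV "\<lambda>p. if p \<in> P then {0..?L} else {undefined}"]
    by (simp add: euclidean_product_topology)
  have "allocations P \<T> c = {y \<in> ?B. sum y P = ?L}"
  proof -
    have "y p \<le> ?L" if "y \<in> P \<rightarrow>\<^sub>E {0..}" "sum y P = ?L" "p \<in> P" for y p
      using that member_le_sum[of p P y] finite_players by auto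
    then have "y \<in> ?B" if "y \<in> allocations P \<T> c" for y
      using that unfolding allocations_def PiE_iff extensional_def by simp
    moreover have "y \<in> P \<rightarrow>\<^sub>E {0..}" if "y \<in> ?B" for y
    proof (rule PiE_I)
      fix p show "y p \<in> {0..}" if "p \<in> P" using PiE_mem[OF \<open>y \<in> ?B\<close>, of p] that by simp
      show "y p = undefined" if "p \<notin> P" using PiE_mem[OF \<open>y \<in> ?B\<close>, of p] that by simp
    qed
    ultimately show ?thesis unfolding allocations_def by blast
  qed
  moreover have "compact {y \<in> ?B. sum y P = ?L}"
    by (rule closedin_compact[OF B], rule continuous_closedin_preimage_constant)
      (rule continuous_on_sum_coordinates)
  ultimately show ?thesis by simp
qed

lemma convex_allocations:
  assumes "y \<in> allocations P \<T> c" "z \<in> allocations P \<T> c"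
  shows "(\<lambda>p\<in>P. (y p + z p) / 2) \<in> allocations P \<T> c"
  using allocationsD[OF assms(1)] allocationsD[OF assms(2)]
  by (auto simp: allocations_def sum.distrib sum_divide_distrib[symmetric])

lemma transfer_allocation:
  assumes y: "y \<in> allocations P \<T> c" and "p \<in> P" "q \<in> P" "p \<noteq> q" "0 \<le> t" "t \<le> y p"
  shows "y(p := y p - t, q := y q + t) \<in> allocations P \<T> c"
proof -
  let ?y = "\<lambda>r. y r + ((if r = q then t else 0) - (if r = p then t else 0))"
  have eq: "y(p := y p - t, q := y q + t) = ?y" using assms by auto
  have "sum ?y P = sum y P"
    using assms finite_players by (simp add: sum.distrib sum_subtractf)
  then show ?thesis unfolding eq using assms by (auto simp: allocations_def PiE_iff extensional_def)
qed

text \<open>A penalty argument replaces Farkas' lemma: at an allocation minimizing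
  \<open>\<Sum>T\<in>\<T>. (max 0 (sum y T - c T))\<^sup>2\<close>, the first-order conditions make the residuals
  \<open>max 0 (sum y T - c T)\<close>, suitably scaled, a fractional cover, and it would be too cheap
  unless they all vanish.\<close>

lemma dual_feasible_allocation_exists:
  obtains y where "y \<in> allocations P \<T> c" "\<And>T. T \<in> \<T> \<Longrightarrow> sum y T \<le> c T"
proof -
  let ?L = "lp_value P \<T> c"
  define G where "G y = (\<Sum>T\<in>\<T>. (max 0 (sum y T - c T))\<^sup>2)" for y
  have "continuous_on (allocations P \<T> c) G" unfolding G_def
    by (intro continuous_intros continuous_on_sum_coordinates)
  then obtain y where y: "y \<in> allocations P \<T> c"
    and min: "\<And>z. z \<in> allocations P \<T> c \<Longrightarrow> G y \<le> G z"
    using continuous_attains_inf[OF compact_allocations allocations_nonempty] by metis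
  define x where "x T = max 0 (sum y T - c T)" for T
  define X where "X p = (\<Sum>T\<in>{T \<in> \<T>. p \<in> T}. x T)" for p
  have x0: "0 \<le> x T" for T by (simp add: x_def)
  have X0: "0 \<le> X p" for p unfolding X_def by (intro sum_nonneg x0)
  have first_order: "X p \<le> X q" if p: "p \<in> P" "0 < y p" and q: "q \<in> P" for p q
  proof (cases "p = q")
    case False
    \<comment> \<open>\<open>\<delta> T\<close> is the change of \<open>sum y T\<close> per unit
      moved from \<open>p\<close> to \<open>q\<close>; \<open>N\<close> will be the coefficient of
      the quadratic error.\<close>
    define \<delta> :: "'a set \<Rightarrow> real" where "\<delta> T = of_bool (q \<in> T) - of_bool (p \<in> T)" for T
    define N where "N = (\<Sum>T\<in>\<T>. (\<delta> T)\<^sup>2)"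
    have delta: "(\<Sum>T\<in>\<T>. x T * \<delta> T) = X q - X p"
      unfolding \<delta>_def X_def using finite_family
      by (simp add: right_diff_distrib sum_subtractf sum.inter_filter of_bool_def
          mult.commute[of "x _"] if_distribR if_distrib[of "\<lambda>a. a * _"]
          cong: if_cong)
    have ineq: "0 \<le> 2 * (X q - X p) + t * N" if t: "0 < t" "t \<le> y p" for t
    proof -
      let ?z = "y(p := y p - t, q := y q + t)"
      have "sum ?z T = sum y T + t * \<delta> T" if "T \<in> \<T>" for T
      proof -
        have "?z = (\<lambda>r. y r + ((if r = q then t else 0) - (if r = p then t else 0)))"
          using False by auto
        then show ?thesis
          using finite_member[OF that] by (simp add: sum.distrib sum_subtractf \<delta>_def)
      qed
      then have "G ?z = (\<Sum>T\<in>\<T>. (max 0 ((sum y T - c T) + t * \<delta> T))\<^sup>2)"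
        unfolding G_def by (intro sum.cong) (auto simp: algebra_simps)
      also have "\<dots> \<le> (\<Sum>T\<in>\<T>. (x T)\<^sup>2 + 2 * x T * (t * \<delta> T) + (t * \<delta> T)\<^sup>2)"
        unfolding x_def by (intro sum_mono pos_part_sq_add_le)
      also have "\<dots> = G y + 2 * t * (\<Sum>T\<in>\<T>. x T * \<delta> T) + t\<^sup>2 * N"
        unfolding G_def N_def x_def
        by (simp add: sum.distrib sum_distrib_left power_mult_distrib algebra_simps)
      finally have "G ?z \<le> G y + 2 * t * (X q - X p) + t\<^sup>2 * N" unfolding delta .
      moreover have "G y \<le> G ?z"
        using min transfer_allocation[OF y p(1) q False] t by simp
      ultimately have "0 \<le> t * (2 * (X q - X p) + t * N)"
        by (simp add: power2_eq_square algebra_simps)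
      then show ?thesis using t(1) by (simp add: zero_le_mult_iff)
    qed
    have "0 \<le> N" unfolding N_def by (intro sum_nonneg) simp
    show ?thesis
    proof (rule ccontr)
      assume "\<not> X p \<le> X q"
      \<comment> \<open>Small enough that \<open>y p\<close> stays nonnegative after the transfer
        and that the first-order decrease of \<open>G\<close> outweighs the quadratic error; the
        added 1 keeps the denominator positive.\<close>
      define t where "t = min (y p) ((X p - X q) / (N + 1))"
      have t: "0 < t" "t \<le> y p" "t \<le> (X p - X q) / (N + 1)"
        using \<open>\<not> X p \<le> X q\<close> \<open>0 \<le> N\<close> p(2) by (auto simp: t_def)
      have "t * N \<le> t * (N + 1)" using t(1) by simp
      also have "\<dots> \<le> X p - X q" using t(3) \<open>0 \<le> N\<close> by (simp add: field_simps)
      finally show False using ineq[OF t(1,2)] \<open>\<not> X p \<le> X q\<close> by simp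
    qed
  qed simp
  \<comment> \<open>Complementary slackness: \<open>X\<close> attains its minimum over
    \<open>P\<close> wherever \<open>y\<close> is positive, and \<open>\<mu>\<close> is that
    minimum. If \<open>y\<close> vanishes on \<open>P\<close>, then \<open>0\<close> serves.\<close>
  obtain \<mu> where mu: "0 \<le> \<mu>" "\<And>q. q \<in> P \<Longrightarrow> \<mu> \<le> X q" "\<And>q. q \<in> P \<Longrightarrow> y q * X q = y q * \<mu>"
  proof (cases "\<exists>p\<in>P. 0 < y p")
    case True
    then obtain p where p: "p \<in> P" "0 < y p" by blast
    show ?thesis
    proof (rule that[of "X p"])
      fix q assume q: "q \<in> P"
      show "X p \<le> X q" by (rule first_order[OF p q])
      show "y q * X q = y q * X p"
        using first_order[OF p q] first_order[OF q _ p(1)] allocationsD(1)[OF y q] by (cases "y q = 0") auto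
    qed (rule X0)
  next
    case False
    then have "y q = 0" if "q \<in> P" for q using allocationsD(1)[OF y that] that by force
    then show ?thesis using X0 by (intro that[of 0]) auto
  qed
  have "(\<Sum>T\<in>\<T>. x T * sum y T) = (\<Sum>p\<in>P. y p * \<mu>)"
    unfolding sum_members_swap[OF subset_refl] X_def[symmetric] using mu(3) by (rule sum.cong[OF refl])
  then have total: "(\<Sum>T\<in>\<T>. x T * sum y T) = \<mu> * ?L"
    using allocationsD(2)[OF y] by (simp add: sum_distrib_left[symmetric] mult.commute)
  \<comment> \<open>Either \<open>x T = 0\<close> or \<open>x T = sum y T - c T\<close>.\<close>
  have "x T * c T = x T * sum y T - (x T)\<^sup>2" for T
    by (simp add: x_def max_def power2_eq_square algebra_simps)
  then have cost: "(\<Sum>T\<in>\<T>. c T * x T) = \<mu> * ?L - (\<Sum>T\<in>\<T>. (x T)\<^sup>2)"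
    using total by (simp add: sum_subtractf mult.commute)
  have "(\<Sum>T\<in>\<T>. (x T)\<^sup>2) \<le> 0"
  proof (cases "\<mu> = 0")
    case True
    have "0 \<le> (\<Sum>T\<in>\<T>. c T * x T)" using cost_nonneg x0 by (intro sum_nonneg) auto
    then show ?thesis using cost True by simp
  next
    case False
    then have "0 < \<mu>" using mu(1) by simp
    \<comment> \<open>The cost of this cover is \<open>?L\<close> minus the sum of squares divided
      by \<open>\<mu>\<close>, so minimality of \<open>?L\<close> leaves no room for a positive
      residual.\<close>
    have "(\<lambda>T\<in>\<T>. x T / \<mu>) \<in> fractional_covers P \<T>"
      using \<open>0 < \<mu>\<close> x0 mu(2)
      by (auto simp: fractional_covers_def X_def sum_divide_distrib[symmetric])
    from lp_value_le[OF this] have "?L \<le> (\<Sum>T\<in>\<T>. c T * x T) / \<mu>"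
      by (simp add: sum_divide_distrib)
    then show ?thesis using cost \<open>0 < \<mu>\<close> by (simp add: field_simps)
  qed
  then have "(\<Sum>T\<in>\<T>. (x T)\<^sup>2) = 0" by (simp add: order.antisym sum_nonneg)
  then have "\<forall>T\<in>\<T>. x T = 0" using finite_family by (simp add: sum_nonneg_eq_0_iff)
  then show ?thesis using y by (intro that[of y]) (auto simp: x_def max_def split: if_splits)
qed

section \<open>Excesses of covering pairs\<close>

lemma pair_excess_eq: "pair_excess c y (S, \<U>) = sum c \<U> - sum y S"
  by (simp add: pair_excess_def)

lemma C_star_subset_covering_pairs: "C_star P \<T> \<subseteq> covering_pairs P \<T>"
  using Union_family
  by (auto simp: C_star_def covering_pairs_def coalitions_def covers_of_def)

lemma C_star_star_subset_covering_pairs: "C_star_star P \<T> c \<subseteq> covering_pairs P \<T>"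
  using C_star_subset_covering_pairs by (auto simp: C_star_star_def)

lemma continuous_on_pair_excess: "continuous_on Y (\<lambda>y. pair_excess c y q)"
  by (cases q) (simp add: pair_excess_eq continuous_on_diff continuous_on_sum_coordinates)

text \<open>The minimum over the finitely many covers is attained, so a pair violating the cost
  condition can be exchanged for a cheaper one with the same coalition. This is the descent step of
  both inductions below.\<close>

lemma C_star_cheaper_cover:
  assumes "(S, {T}) \<in> C_star P \<T>" "(S, {T}) \<notin> C_star_star P \<T> c"
  obtains \<U> where "(S, \<U>) \<in> covering_pairs P \<T>" "sum c \<U> < c T"
proof -
  let ?M = "sum c ` covers_of \<T> S"
  have T: "{T} \<in> covers_of \<T> S" and S: "S \<in> coalitions P"
    using assms(1) C_star_subset_covering_pairs by (auto simp: covering_pairs_def)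
  have fin: "finite ?M" using finite_covers_of by simp
  have "c T \<noteq> Min ?M" using assms by (auto simp: C_star_star_def C_star_def)
  moreover have "Min ?M \<le> c T"
    using Min_le[OF fin imageI[OF T]] by simp
  moreover have "Min ?M \<in> ?M" using fin T by (intro Min_in) auto
  ultimately show ?thesis using that S by (auto simp: covering_pairs_def)
qed

text \<open>Induction on the number of cheaper members of \<open>\<T>\<close>. A violated
  \<open>T\<close> is neither empty nor \<open>P\<close>, so it would have a strictly cheaper cover.
  As costs are nonnegative, each member of that cover is cheaper than \<open>T\<close> and obeys the
  bound by induction; the union bound for \<open>y\<close> then contradicts the violation.\<close>

lemma dual_feasible_if_C_star_star:
  assumes y: "y \<in> allocations P \<T> c"
    and nonneg: "\<And>q. q \<in> C_star_star P \<T> c \<Longrightarrow> 0 \<le> pair_excess c y q"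
    and "T \<in> \<T>"
  shows "sum y T \<le> c T"
  using \<open>T \<in> \<T>\<close>
proof (induction "card {T' \<in> \<T>. c T' < c T}" arbitrary: T rule: less_induct)
  case less
  show ?case
  proof (rule ccontr)
    assume bad: "\<not> sum y T \<le> c T"
    then have "T \<noteq> {}" using cost_nonneg[OF less.prems] by auto
    moreover have "T \<noteq> P"
      using bad lp_value_le_cost_P allocationsD(2)[OF y] less.prems by auto
    ultimately have star: "(T, {T}) \<in> C_star P \<T>" using less.prems by (auto simp: C_star_def)
    have "(T, {T}) \<notin> C_star_star P \<T> c"
      using bad nonneg[of "(T, {T})"] by (auto simp: pair_excess_eq)
    then obtain \<U> where \<U>: "(T, \<U>) \<in> covering_pairs P \<T>" "sum c \<U> < c T"
      using C_star_cheaper_cover[OF star] by blast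
    have sub: "\<U> \<subseteq> \<T>" "T \<subseteq> \<Union>\<U>" using \<U>(1) by (auto simp: covering_pairs_def covers_of_def)
    have fin: "finite \<U>" using sub(1) finite_family finite_subset by blast
    have "sum y T' \<le> c T'" if T': "T' \<in> \<U>" for T'
    proof (rule less.hyps)
      have "c T' \<le> sum c \<U>" using T' fin sub(1) cost_nonneg by (intro member_le_sum) auto
      then have lt: "c T' < c T" using \<U>(2) by simp
      show "T' \<in> \<T>" using T' sub(1) by blast
      then show "card {R \<in> \<T>. c R < c T'} < card {R \<in> \<T>. c R < c T}"
        using lt finite_family by (intro psubset_card_mono) auto
    qed
    then have "(\<Sum>T'\<in>\<U>. sum y T') \<le> sum c \<U>" by (rule sum_mono)
    moreover have "sum y T \<le> (\<Sum>T'\<in>\<U>. sum y T')"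
    proof -
      have UP: "\<Union>\<U> \<subseteq> P" using sub(1) Union_family by blast
      have "sum y T \<le> sum y (\<Union>\<U>)"
        using sub(2) UP finite_players allocationsD(1)[OF y] by (intro sum_mono2) (auto intro: finite_subset)
      also have "\<dots> \<le> (\<Sum>T'\<in>\<U>. sum y T')"
        using fin UP allocationsD(1)[OF y]
      proof (induction \<U> rule: finite_induct)
        case (insert A F)
        have "finite A" "finite (\<Union>F)"
          using insert.prems(1) finite_players by (auto intro: finite_subset)
        then have "sum y (A \<union> \<Union>F) = sum y A + sum y (\<Union>F) - sum y (A \<inter> \<Union>F)"
          by (rule sum_Un)
        moreover have "0 \<le> sum y (A \<inter> \<Union>F)"
          using insert.prems by (intro sum_nonneg) auto
        ultimately show ?case using insert by auto
      qed simp
      finally show ?thesis .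
    qed
    ultimately show False using bad \<U>(2) by simp
  qed
qed

text \<open>In vector terms: the incidence vector of \<open>S\<close> lies in the span of the incidence vectors of
  \<open>P\<close> and of those coalitions in \<open>C_star_star\<close> whose excess does not exceed \<open>e\<close>.  Slack in
  covering a player \<open>p\<close> of \<open>T\<close> costs at least \<open>y p\<close>, so then both \<open>T\<close> and \<open>T - {p}\<close>
  have small excess.\<close>

lemma sum_eq_0_if_C_star_star:
  assumes y: "y \<in> allocations P \<T> c" and feas: "\<And>T. T \<in> \<T> \<Longrightarrow> sum y T \<le> c T"
    and dP: "sum d P = (0::real)"
    and d0: "\<And>S \<U>. (S, \<U>) \<in> C_star_star P \<T> c \<Longrightarrow> pair_excess c y (S, \<U>) \<le> e \<Longrightarrow> sum d S = 0"
    and SU: "(S, \<U>) \<in> covering_pairs P \<T>" "pair_excess c y (S, \<U>) \<le> e"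
  shows "sum d S = 0"
  using SU
proof (induction "card {q \<in> covering_pairs P \<T>. pair_excess c y q < pair_excess c y (S, \<U>)}"
    arbitrary: S \<U> rule: less_induct)
  case less
  let ?x = "pair_excess c y (S, \<U>)"
  have sub: "S \<subseteq> P" "\<U> \<subseteq> \<T>" "S \<subseteq> \<Union>\<U>"
    using less.prems(1) by (auto simp: covering_pairs_def coalitions_def covers_of_def)
  have fin: "finite \<U>" using sub(2) finite_family finite_subset by blast
  \<comment> \<open>This extends \<open>d0\<close> from \<open>C_star_star\<close> to
    \<open>C_star\<close> up to level \<open>?x\<close>: a pair whose cover is not cheapest is
    replaced by one of strictly smaller excess, to which the induction hypothesis applies.\<close>
  have star: "sum d S' = 0" if ST: "(S', {T}) \<in> C_star P \<T>" "pair_excess c y (S', {T}) \<le> ?x" for S' T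
  proof (cases "(S', {T}) \<in> C_star_star P \<T> c")
    case True
    then show ?thesis using d0 ST(2) less.prems(2) by fastforce
  next
    case False
    then obtain \<U>' where \<U>': "(S', \<U>') \<in> covering_pairs P \<T>" "sum c \<U>' < c T"
      using C_star_cheaper_cover[OF ST(1)] by blast
    then have lt: "pair_excess c y (S', \<U>') < ?x" using ST(2) by (simp add: pair_excess_eq)
    show ?thesis
    proof (rule less.hyps[OF _ \<U>'(1)])
      show "pair_excess c y (S', \<U>') \<le> e" using lt less.prems(2) by simp
      show "card {q \<in> covering_pairs P \<T>. pair_excess c y q < pair_excess c y (S', \<U>')}
          < card {q \<in> covering_pairs P \<T>. pair_excess c y q < ?x}"
        using lt \<U>'(1) finite_covering_pairs by (intro psubset_card_mono) auto
    qed
  qed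
  \<comment> \<open>The incidence vectors of the members of \<open>\<U>\<close> add up to
    \<open>m\<close>, which is the incidence vector of \<open>S\<close> plus the surplus
    \<open>slack\<close>.\<close>
  define m where "m p = real (card {T \<in> \<U>. p \<in> T})" for p
  define slack where "slack p = m p - of_bool (p \<in> S)" for p
  have sum_m: "(\<Sum>T\<in>\<U>. sum f T) = (\<Sum>p\<in>P. f p * m p)" for f :: "'a \<Rightarrow> real"
    using sum_members_swap[OF sub(2), of "\<lambda>_. 1" f] by (simp add: m_def)
  have sum_S: "sum f S = (\<Sum>p\<in>P. f p * of_bool (p \<in> S))" for f :: "'a \<Rightarrow> real"
    using sub(1) finite_players by (simp add: of_bool_def if_distrib sum.If_cases Int_absorb1 cong: if_cong)
  have sum_slack: "(\<Sum>T\<in>\<U>. sum f T) - sum f S = (\<Sum>p\<in>P. f p * slack p)" for f :: "'a \<Rightarrow> real"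
    by (simp add: sum_m sum_S slack_def right_diff_distrib sum_subtractf)
  have slack0: "0 \<le> slack p" for p
  proof -
    have "0 < card {T \<in> \<U>. p \<in> T}" if "p \<in> S" using that sub(3) fin by (auto simp: card_gt_0_iff)
    then show ?thesis by (auto simp: slack_def m_def Suc_le_eq[symmetric])
  qed
  \<comment> \<open>All terms of both sums are nonnegative, so \<open>?x\<close> is at least any one
    term of the first plus any one term of the second.\<close>
  have decomp: "?x = (\<Sum>T\<in>\<U>. c T - sum y T) + (\<Sum>p\<in>P. y p * slack p)"
    by (simp add: pair_excess_eq sum_slack[symmetric] sum_subtractf)
  have T_le: "c T - sum y T \<le> (\<Sum>T\<in>\<U>. c T - sum y T)" if "T \<in> \<U>" for T
    using that fin sub(2) feas by (intro member_le_sum) auto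
  have y_slack: "0 \<le> y p * slack p" if "p \<in> P" for p
    using that allocationsD(1)[OF y] slack0 by simp
  have dT: "sum d T = 0" if T: "T \<in> \<U>" for T
  proof (cases "T = {} \<or> T = P")
    case False
    have "0 \<le> (\<Sum>p\<in>P. y p * slack p)" by (intro sum_nonneg y_slack)
    then have "pair_excess c y (T, {T}) \<le> ?x"
      unfolding decomp using T_le[OF T] by (simp add: pair_excess_eq)
    then show ?thesis using False T sub(2) by (intro star[of T T]) (auto simp: C_star_def)
  qed (use dP in auto)
  have dp: "d p * slack p = 0" if p: "p \<in> P" for p
  proof (cases "slack p = 0")
    case False
    then have pos: "0 < slack p" using slack0[of p] by simp
    then have "m p \<noteq> 0" by (auto simp: slack_def of_bool_def split: if_splits)
    then have "{T \<in> \<U>. p \<in> T} \<noteq> {}" unfolding m_def by (metis card.empty of_nat_0)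
    then obtain T where T: "T \<in> \<U>" "p \<in> T" by blast
    \<comment> \<open>Slack is integral, so a positive slack costs at least the full
      \<open>y p\<close>, which pays for removing \<open>p\<close> from \<open>T\<close>.\<close>
    have "1 \<le> slack p" using pos by (auto simp: slack_def m_def of_bool_def split: if_splits)
    then have "y p \<le> y p * slack p" using allocationsD(1)[OF y p] by (simp add: mult_le_cancel_left1)
    also have "\<dots> \<le> (\<Sum>p\<in>P. y p * slack p)"
      using p finite_players y_slack by (intro member_le_sum) auto
    finally have "c T - sum y T + y p \<le> ?x"
      unfolding decomp using T_le[OF T(1)] by simp
    moreover have fT: "finite T" using T(1) sub(2) finite_member by blast
    ultimately have ex: "pair_excess c y (T - {p}, {T}) \<le> ?x"
      using T(2) by (simp add: pair_excess_eq sum_diff1)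
    have "sum d (T - {p}) = 0"
    proof (cases "T - {p} = {}")
      case False
      show ?thesis
        by (rule star[OF _ ex]) (use False T p sub(2) in \<open>auto simp: C_star_def\<close>)
    next
      case True
      show ?thesis unfolding True by simp
    qed
    then have "d p = 0" using dT[OF T(1)] T(2) fT by (simp add: sum_diff1)
    then show ?thesis by simp
  qed simp
  show ?case using sum_slack[of d] dT dp by simp
qed

text \<open>The index set \<open>I\<close> is abstract so that one argument serves both families of
  pairs and coalition excesses. By \<open>sound\<close> each entry is the excess of some pair for
  all vectors at once; by \<open>complete\<close> the pairs in \<open>C_star_star\<close> all
  occur.\<close>

lemma C_star_star_maximizer_dominates:
  assumes y: "y \<in> allocations P \<T> c"
    and max: "\<And>z. z \<in> allocations P \<T> c \<Longrightarrow>
      excess_vector_on (C_star_star P \<T> c) c z \<le> excess_vector_on (C_star_star P \<T> c) c y"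
    and fin: "finite I"
    and sound: "\<And>i. i \<in> I \<Longrightarrow> \<exists>q\<in>covering_pairs P \<T>. \<forall>z. f z i = pair_excess c z q"
    and complete: "\<And>q. q \<in> C_star_star P \<T> c \<Longrightarrow> \<exists>i\<in>I. \<forall>z. f z i = pair_excess c z q"
    and z: "z \<in> allocations P \<T> c" "z \<noteq> y"
  shows "sorted_values (f z) I < sorted_values (f y) I"
proof -
  let ?C = "C_star_star P \<T> c"
  have finC: "finite ?C"
    using C_star_star_subset_covering_pairs finite_covering_pairs finite_subset by blast
  \<comment> \<open>Compare \<open>y\<close> with an allocation \<open>x\<close> that charges no
    \<open>T\<close> more than \<open>c T\<close>. The first level \<open>e\<close> at which they
    differ is an excess of \<open>x\<close>, hence nonnegative; excesses of \<open>x\<close> below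
    \<open>e\<close> are unchanged for \<open>y\<close>, the others stay at least
    \<open>e\<close>.\<close>
  have nonneg: "0 \<le> pair_excess c y q" if q: "q \<in> ?C" for q
  proof -
    obtain x where x: "x \<in> allocations P \<T> c" "\<And>T. T \<in> \<T> \<Longrightarrow> sum x T \<le> c T"
      using dual_feasible_allocation_exists by metis
    have pos: "0 \<le> pair_excess c x q'" if "q' \<in> ?C" for q'
    proof -
      from that obtain S T where q': "q' = (S, {T})" "T \<in> \<T>" "S \<subseteq> T"
        by (auto simp: C_star_star_def C_star_def)
      have "sum x S \<le> sum x T"
        using q' Union_family allocationsD(1)[OF x(1)] finite_member by (intro sum_mono2) auto
      then show ?thesis using x(2)[OF q'(2)] q'(1) by (simp add: pair_excess_eq)
    qed
    show ?thesis
    proof (cases "\<exists>q\<in>?C. pair_excess c x q \<noteq> pair_excess c y q")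
      case False
      then show ?thesis using pos[OF q] q by auto
    next
      case True
      obtain e i where "i \<in> ?C" "pair_excess c x i = e"
        and *: "\<And>j. j \<in> ?C \<Longrightarrow> pair_excess c x j < e \<Longrightarrow> pair_excess c y j = pair_excess c x j"
        "\<And>j. j \<in> ?C \<Longrightarrow> e \<le> pair_excess c x j \<Longrightarrow> e \<le> pair_excess c y j"
        using sorted_values_le_cases[OF finC max[OF x(1), unfolded excess_vector_on_def] True] by metis
      then have "0 \<le> e" using pos by blast
      then show ?thesis using *[OF q] pos[OF q] by (cases "pair_excess c x q < e") auto
    qed
  qed
  note feas = dual_feasible_if_C_star_star[OF y nonneg]
  define d where "d p = z p - y p" for p
  have sum_d: "sum d S = sum z S - sum y S" for S by (simp add: d_def sum_subtractf)
  have dP: "sum d P = 0" using allocationsD(2)[OF y] allocationsD(2)[OF z(1)] by (simp add: sum_d)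
  have span: "pair_excess c z q = pair_excess c y q"
    if C: "\<And>q'. q' \<in> ?C \<Longrightarrow> pair_excess c y q' \<le> e \<Longrightarrow> pair_excess c z q' = pair_excess c y q'"
      and q: "q \<in> covering_pairs P \<T>" "pair_excess c y q \<le> e" for q e
  proof -
    obtain S \<U> where SU: "q = (S, \<U>)" by (cases q)
    have "sum d S = 0"
    proof (rule sum_eq_0_if_C_star_star[OF y feas dP])
      fix S' \<U>' assume "(S', \<U>') \<in> ?C" "pair_excess c y (S', \<U>') \<le> e"
      then show "sum d S' = 0" using C by (force simp: pair_excess_eq sum_d)
    qed (use q SU in auto)
    then show ?thesis by (simp add: SU pair_excess_eq sum_d)
  qed
  show ?thesis
  proof (rule ccontr)
    assume "\<not> ?thesis"
    then have le: "sorted_values (f y) I \<le> sorted_values (f z) I" by simp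
    have "\<exists>i\<in>I. f y i \<noteq> f z i"
    proof (rule ccontr)
      assume "\<not> ?thesis"
      then have all: "pair_excess c z q = pair_excess c y q" if "q \<in> ?C" for q
        using complete[OF that] by force
      have "z p = y p" for p
      proof (cases "p \<in> P")
        case True
        \<comment> \<open>Singleton coalitions separate vectors, and the whole family covers
          them.\<close>
        then have "({p}, \<T>) \<in> covering_pairs P \<T>"
          using Union_family by (auto simp: covering_pairs_def coalitions_def covers_of_def)
        from span[OF all this order_refl] show ?thesis by (simp add: pair_excess_eq)
      next
        case False
        then show ?thesis using y z(1) by (auto simp: allocations_def PiE_iff extensional_def)
      qed
      then show False using z(2) by blast
    qed
    from sorted_values_le_cases[OF fin le this] obtain e i
      where i: "i \<in> I" "f y i = e" "e < f z i"
        and lt: "\<And>j. j \<in> I \<Longrightarrow> f y j < e \<Longrightarrow> f z j = f y j"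
        and ge: "\<And>j. j \<in> I \<Longrightarrow> e \<le> f y j \<Longrightarrow> e \<le> f z j" by metis
    have ltC: "pair_excess c z q = pair_excess c y q" if "q \<in> ?C" "pair_excess c y q < e" for q
      using complete[OF that(1)] lt that(2) by force
    have geC: "e \<le> pair_excess c z q" if "q \<in> ?C" "e \<le> pair_excess c y q" for q
      using complete[OF that(1)] ge that(2) by force
    obtain q\<^sub>i where q\<^sub>i: "q\<^sub>i \<in> covering_pairs P \<T>" "\<And>z. f z i = pair_excess c z q\<^sub>i"
      using sound[OF i(1)] by blast
    obtain q\<^sub>0 where q0: "q\<^sub>0 \<in> ?C" "pair_excess c y q\<^sub>0 \<le> e" "pair_excess c z q\<^sub>0 \<noteq> pair_excess c y q\<^sub>0"
      using span[of e q\<^sub>i] q\<^sub>i i by fastforce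
    \<comment> \<open>By \<open>span\<close>, the difference at \<open>i\<close> forces one on
      \<open>?C\<close> at level at most \<open>e\<close>. \<open>ltC\<close> excludes smaller
      levels and \<open>geC\<close> fixes its direction.\<close>
    then have q0': "pair_excess c y q\<^sub>0 = e" "e < pair_excess c z q\<^sub>0"
      using ltC[OF q0(1)] geC[OF q0(1)] by force+
    \<comment> \<open>An excess above \<open>e\<close> for \<open>y\<close> may drop to exactly
      \<open>e\<close> for \<open>z\<close>; averaging with \<open>y\<close> keeps it strictly above
      \<open>e\<close>.\<close>
    define w where "w = (\<lambda>p\<in>P. (y p + z p) / 2)"
    have w: "w \<in> allocations P \<T> c" unfolding w_def by (rule convex_allocations[OF y z(1)])
    have mid: "pair_excess c w q = (pair_excess c y q + pair_excess c z q) / 2" if "q \<in> ?C" for q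
    proof -
      obtain S \<U> where SU: "q = (S, \<U>)" by (cases q)
      then have "S \<subseteq> P"
        using that C_star_star_subset_covering_pairs by (auto simp: covering_pairs_def coalitions_def)
      then have "sum w S = (\<Sum>p\<in>S. (y p + z p) / 2)"
        unfolding w_def by (intro sum.cong) auto
      then have "sum w S = (sum y S + sum z S) / 2"
        by (simp add: sum.distrib sum_divide_distrib[symmetric])
      then show ?thesis by (simp add: SU pair_excess_eq field_simps)
    qed
    have "excess_vector_on ?C c y < excess_vector_on ?C c w"
      unfolding excess_vector_on_def
    proof (rule sorted_values_less[where e = e and j\<^sub>0 = q\<^sub>0, OF finC])
      show "q\<^sub>0 \<in> ?C" "pair_excess c y q\<^sub>0 = e" using q0(1) q0'(1) .
      show "e < pair_excess c w q\<^sub>0" using mid[OF q0(1)] q0' by simp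
    next
      fix q assume q: "q \<in> ?C"
      show "pair_excess c w q = pair_excess c y q" if "pair_excess c y q < e"
        using mid[OF q] ltC[OF q that] by simp
      show "e \<le> pair_excess c w q" if "pair_excess c y q = e"
        using mid[OF q] geC[OF q] that by simp
      show "e < pair_excess c w q" if "e < pair_excess c y q"
        using mid[OF q] geC[OF q] that by simp
    qed
    with max[OF w] show False by simp
  qed
qed

text \<open>The term \<open>sum y S\<close> does not depend on the cover, so one cheapest cover of
  \<open>S\<close> attains the minimum for all \<open>y\<close> simultaneously.\<close>

lemma coalition_excess_eq:
  assumes "S \<in> coalitions P"
  shows "coalition_excess \<T> c y S = Min (sum c ` covers_of \<T> S) - sum y S"
    and "\<exists>\<U>\<in>covers_of \<T> S. Min (sum c ` covers_of \<T> S) = sum c \<U>"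
proof -
  have ne: "covers_of \<T> S \<noteq> {}"
    using assms Union_family by (auto simp: coalitions_def covers_of_def)
  have "(\<lambda>\<U>. pair_excess c y (S, \<U>)) ` covers_of \<T> S
      = (\<lambda>v. v + (- sum y S)) ` (sum c ` covers_of \<T> S)"
    by (simp add: pair_excess_eq image_image)
  then show "coalition_excess \<T> c y S = Min (sum c ` covers_of \<T> S) - sum y S"
    unfolding coalition_excess_def
    using Min_add_commute[of "covers_of \<T> S" "sum c" "- sum y S"] finite_covers_of ne
    by (simp add: image_image)
  have "Min (sum c ` covers_of \<T> S) \<in> sum c ` covers_of \<T> S"
    by (rule Min_in) (use finite_covers_of ne in auto)
  then show "\<exists>\<U>\<in>covers_of \<T> S. Min (sum c ` covers_of \<T> S) = sum c \<U>" by blast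
qed

end

section \<open>Uniqueness of the lexicographic maximizer and the happy nucleolus\<close>

lemma lex_maximizes_unique:
  assumes "y \<in> Y" "\<And>z. z \<in> Y \<Longrightarrow> z \<noteq> y \<Longrightarrow> \<theta> z < \<theta> y"
  shows "lex_maximizes \<theta> Y z \<longleftrightarrow> z = y"
  unfolding lex_maximizes_def is_arg_max_def
  using assms by (metis order_less_asym order_less_irrefl)

theorem theorem1:
  fixes P :: "'a set" and \<T> :: "'a set set" and c :: "'a set \<Rightarrow> real"
    and \<C> :: "('a set \<times> 'a set set) set"
  assumes "set_covering_instance P \<T> c"
    and "C_star_star P \<T> c \<subseteq> \<C>"
    and "\<C> \<subseteq> covering_pairs P \<T>"
  shows "determines_happy_nucleolus P \<T> c \<C>"
proof -
  interpret set_covering_instance P \<T> c by fact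
  let ?C = "C_star_star P \<T> c" and ?Y = "allocations P \<T> c"
  have finC: "finite ?C"
    using C_star_star_subset_covering_pairs finite_covering_pairs finite_subset by blast
  \<comment> \<open>The maximizer for \<open>?C\<close> alone strictly dominates all other
    allocations both on \<open>\<C>\<close> and for coalition excesses, so the two maximizers
    coincide.\<close>
  obtain y where y: "y \<in> ?Y" and max: "\<And>z. z \<in> ?Y \<Longrightarrow> excess_vector_on ?C c z \<le> excess_vector_on ?C c y"
    using sorted_values_max_exists[OF finC compact_allocations allocations_nonempty,
        of "\<lambda>q y. pair_excess c y q", OF continuous_on_pair_excess]
    unfolding excess_vector_on_def by blast
  have "excess_vector_on \<C> c z < excess_vector_on \<C> c y" if "z \<in> ?Y" "z \<noteq> y" for z
    unfolding excess_vector_on_def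
    by (rule C_star_star_maximizer_dominates[OF y max])
      (use assms(2,3) that finite_covering_pairs finite_subset in blast)+
  then have "lex_maximizes (excess_vector_on \<C> c) ?Y = (\<lambda>z. z = y)"
    by (intro ext lex_maximizes_unique[OF y])
  moreover have "excess_vector P \<T> c z < excess_vector P \<T> c y" if "z \<in> ?Y" "z \<noteq> y" for z
    unfolding excess_vector_def
  proof (rule C_star_star_maximizer_dominates[OF y max finite_coalitions _ _ that])
    fix S assume S: "S \<in> coalitions P"
    then show "\<exists>q\<in>covering_pairs P \<T>. \<forall>z. coalition_excess \<T> c z S = pair_excess c z q"
      using coalition_excess_eq[OF S] by (fastforce simp: covering_pairs_def pair_excess_eq)
  next
    \<comment> \<open>The cost condition in \<open>C_star_star\<close> makes the excess of such a
      pair equal to that of its coalition.\<close>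
    fix q assume q: "q \<in> ?C"
    then obtain S T where ST: "q = (S, {T})" "c T = Min (sum c ` covers_of \<T> S)"
      by (auto simp: C_star_star_def)
    moreover have "S \<in> coalitions P"
      using q ST(1) C_star_star_subset_covering_pairs by (auto simp: covering_pairs_def)
    ultimately show "\<exists>S\<in>coalitions P. \<forall>z. coalition_excess \<T> c z S = pair_excess c z q"
      using coalition_excess_eq(1) by (auto simp: pair_excess_eq)
  qed
  then have "lex_maximizes (excess_vector P \<T> c) ?Y = (\<lambda>z. z = y)"
    by (intro ext lex_maximizes_unique[OF y])
  ultimately show ?thesis
    by (simp add: determines_happy_nucleolus_def happy_nucleolus_def)
qed

end
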